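(* Consider the multi-cone SOCO pair and its SDO counterpart with block-diagonal arrow-head data $\tilde A_j,\tilde C$ (defined in the context), with feasible sets $\mathcal F_P,\mathcal F_D$ and $\mathcal F_P^{SDO},\mathcal F_D^{SDO}$ respectively. Let $u_i=1+\sum_{k=0}^{i-1}n_k$ with $n_0=0$, for $i=1,\dots,r$. Define the mapping $\mathcal M$ sending $(\bar x^1;\dots;\bar x^r;\bar y;\bar s^1;\dots;\bar s^r)\in\mathcal F_P\times\mathcal F_D$ to all $(\tilde X,\tilde y,\tilde S)$ with $$\tilde S=\mathrm{DArw}(\bar s^1,\dots,\bar s^r),\qquad \tilde y=\bar y,$$ $$\tilde X\succeq0,\quad \sum_{j=u_i}^{u_i+n_i-1}\tilde X_{jj}=\bar x^i_1,\quad \tilde X_{u_i,u_i+j-1}=\frac{\bar x^i_j}{2}\ (j=2,\dots,n_i),\quad i=1,\dots,r,$$ and the inverse mapping $\mathcal M^{-1}$ sending $(\tilde X,\tilde y,\tilde S)\in\mathcal F_P^{SDO}\times\mathcal F_D^{SDO}$ to $(\bar x^1;\dots;\bar x^r;\bar y;\bar s^1;\dots;\bar s^r)$ with $$(\bar s^1;\dots;\bar s^r)=\mathrm{DArw}^{-1}(\tilde S),\qquad \bar y=\tilde y,\qquad \bar x^i=\Big(\sum_{j=u_i}^{u_i+n_i-1}\tilde X_{jj},\,2\tilde X_{u_i,u_i+1},\dots,2\tilde X_{u_i,u_i+n_i-1}\Big)^T,\ i=1,\dots,r.$$ Then $\mathcal M$, coupled with $\mathcal M^{-1}$, is an admissible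 mapping.
   Context: Data: $r\ge1$, cone dimensions $n_1,\dots,n_r$, $\bar n=\sum_i n_i$, $A^i\in\mathbb R^{m\times n_i}$, $c^i\in\mathbb R^{n_i}$, $b\in\mathbb R^m$; $A^i_j$ denotes row $j$ of $A^i$. $\mathcal L^{k}=\{x\in\mathbb R^k:x_1\ge\|x_{2:k}\|_2\}$, $x_{2:k}=(x_2,\dots,x_k)$. $\mathrm{Arw}(x)=\begin{pmatrix}x_1&x_{2:k}^T\\ x_{2:k}&x_1I_{k-1}\end{pmatrix}$ for $x\in\mathbb R^k$, and $\mathrm{DArw}(x^1,\dots,x^r)$ is the block-diagonal matrix with diagonal blocks $\mathrm{Arw}(x^1),\dots,\mathrm{Arw}(x^r)$; $\mathrm{DArw}^{-1}$ recovers $(x^1;\dots;x^r)$ from such a matrix (every feasible $\tilde S$ below has this form). SOCO pair: $\min\{\sum_i(c^i)^T\bar x^i:\sum_iA^i\bar x^i=b,\ \bar x^i\in\mathcal L^{n_i}\ \forall i\}$ and $\max\{b^T\bar y:(A^i)^T\bar y+\bar s^i=c^i,\ \bar s^i\in\mathcal L^{n_i}\ \forall i\}$. SDO pair: with $\tilde C=\mathrm{DArw}(c^1,\dots,c^r)$ and $\tilde A_j=\mathrm{DArw}(A^1_j,\dots,A^r_j)$, $j=1,\dots,m$: $\min\{\mathrm{Tr}(\tilde C\tilde X):\mathrm{Tr}(\tilde A_j\tilde X)=b_j,\ j=1,\dots,m,\ \tilde X\succeq0\}$ and $\max\{b^Ty:\sum_{j=1}^my_j\tilde A_j+\tilde S=\tilde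 C,\ \tilde S\succeq0\}$, over real symmetric $\bar n\times\bar n$ matrices $\tilde X$, $\tilde S$ ($\tilde X$ need not be block diagonal). Admissible: $\mathcal M$ with inverse mapping $\mathcal M^{-1}$ is admissible if it preserves feasibility and objective values, i.e. points of $\mathcal F_P\times\mathcal F_D$ are mapped by $\mathcal M$ into $\mathcal F_P^{SDO}\times\mathcal F_D^{SDO}$ (for a point-to-set map: every element of the image is feasible); points of $\mathcal F_P^{SDO}\times\mathcal F_D^{SDO}$ are mapped by $\mathcal M^{-1}$ into $\mathcal F_P\times\mathcal F_D$; and $\sum_i(c^i)^T\bar x^i=\mathrm{Tr}(\tilde C\tilde X)$, $b^T\bar y=b^T\tilde y$ for corresponding points. *)

theory Defs
  imports Complex_Main "Jordan_Normal_Form.Matrix"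
begin

text \<open>
  Vectors and matrices are those of \<^theory>\<open>Jordan_Normal_Form.Matrix\<close>, so all indices
  start at 0: the component $x_1$ is \<open>x $ 0\<close>.  A tuple $(x^1;\dots;x^r)$ is a list of vectors;
  the list \<open>ns\<close> holds the cone dimensions $n_1,\dots,n_r$.
\<close>

definition block_vecs :: "nat list \<Rightarrow> real vec list set" where
  "block_vecs ns = {xs. length xs = length ns \<and> (\<forall>i < length ns. xs ! i \<in> carrier_vec (ns ! i))}"

definition vec_tail :: "real vec \<Rightarrow> real vec" where
  "vec_tail x = vec (dim_vec x - 1) (\<lambda>j. x $ Suc j)"

definition norm2 :: "real vec \<Rightarrow> real" where
  "norm2 x = sqrt (x \<bullet> x)"

definition lorentz_cone :: "nat \<Rightarrow> real vec set" where
  "lorentz_cone k = {x \<in> carrier_vec k. x $ 0 \<ge> norm2 (vec_tail x)}"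

definition Arw :: "real vec \<Rightarrow> real mat" where
  "Arw x = four_block_mat
     (mat 1 1 (\<lambda>_. x $ 0)) (mat_of_rows (dim_vec x - 1) [vec_tail x])
     (mat_of_cols (dim_vec x - 1) [vec_tail x]) (x $ 0 \<cdot>\<^sub>m 1\<^sub>m (dim_vec x - 1))"

definition DArw :: "real vec list \<Rightarrow> real mat" where
  "DArw xs = diag_block_mat (map Arw xs)"

text \<open>
  The inverse of \<^const>\<open>DArw\<close> on tuples with block sizes \<open>ns\<close>.  Its value is meaningful only
  on matrices of the form \<open>DArw xs\<close>; for all \<open>n\<^sub>i \<ge> 1\<close> such \<open>xs \<in> block_vecs ns\<close> is unique.
\<close>

definition DArw_inv :: "nat list \<Rightarrow> real mat \<Rightarrow> real vec list" where
  "DArw_inv ns = inv_into (block_vecs ns) DArw"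

definition mat_trace :: "real mat \<Rightarrow> real" where
  "mat_trace X = (\<Sum>i < dim_row X. X $$ (i, i))"

definition psd_mats :: "nat \<Rightarrow> real mat set" where
  "psd_mats n = {X \<in> carrier_mat n n. transpose_mat X = X \<and>
     (\<forall>v \<in> carrier_vec n. v \<bullet> (X *\<^sub>v v) \<ge> 0)}"


subsection \<open>The second-order cone pair\<close>

definition soco_primal :: "nat list \<Rightarrow> nat \<Rightarrow> real mat list \<Rightarrow> real vec \<Rightarrow> real vec list set" where
  "soco_primal ns m As b = {xs \<in> block_vecs ns.
     finsum_vec TYPE(real) m (\<lambda>i. As ! i *\<^sub>v xs ! i) {..<length ns} = b \<and>
     (\<forall>i < length ns. xs ! i \<in> lorentz_cone (ns ! i))}"

definition soco_dual ::
  "nat list \<Rightarrow> nat \<Rightarrow> real mat list \<Rightarrow> real vec list \<Rightarrow> (real vec \<times> real vec list) set" where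
  "soco_dual ns m As cs = {(y, ss). y \<in> carrier_vec m \<and> ss \<in> block_vecs ns \<and>
     (\<forall>i < length ns. transpose_mat (As ! i) *\<^sub>v y + ss ! i = cs ! i \<and>
        ss ! i \<in> lorentz_cone (ns ! i))}"

definition soco_primal_obj :: "real vec list \<Rightarrow> real vec list \<Rightarrow> real" where
  "soco_primal_obj cs xs = (\<Sum>i < length cs. cs ! i \<bullet> xs ! i)"


subsection \<open>The semidefinite pair\<close>

definition sdo_C :: "real vec list \<Rightarrow> real mat" where
  "sdo_C cs = DArw cs"

definition sdo_A :: "real mat list \<Rightarrow> nat \<Rightarrow> real mat" where
  "sdo_A As j = DArw (map (\<lambda>A. row A j) As)"

definition sdo_primal :: "nat list \<Rightarrow> nat \<Rightarrow> real mat list \<Rightarrow> real vec \<Rightarrow> real mat set" where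
  "sdo_primal ns m As b = {X \<in> psd_mats (sum_list ns).
     \<forall>j < m. mat_trace (sdo_A As j * X) = b $ j}"

definition sdo_dual ::
  "nat list \<Rightarrow> nat \<Rightarrow> real mat list \<Rightarrow> real vec list \<Rightarrow> (real vec \<times> real mat) set" where
  "sdo_dual ns m As cs = {(y, S). y \<in> carrier_vec m \<and> S \<in> psd_mats (sum_list ns) \<and>
     mat (sum_list ns) (sum_list ns) (\<lambda>kl. \<Sum>j < m. y $ j * sdo_A As j $$ kl) + S = sdo_C cs}"

definition sdo_primal_obj :: "real vec list \<Rightarrow> real mat \<Rightarrow> real" where
  "sdo_primal_obj cs X = mat_trace (sdo_C cs * X)"


subsection \<open>Admissible mappings\<close>

text \<open>
  \<open>F\<^sub>P, F\<^sub>D, f\<^sub>P, f\<^sub>D\<close> are the feasible sets and objectives of the source pair, \<open>G\<^sub>P, G\<^sub>D, g\<^sub>P, g\<^sub>D\<close>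
  those of the target pair.  \<open>M\<close> is point-to-set; two feasible points correspond if \<open>M\<close> or
  \<open>Minv\<close> relates them.
\<close>

definition admissible ::
  "'p set \<Rightarrow> 'd set \<Rightarrow> ('p \<Rightarrow> real) \<Rightarrow> ('d \<Rightarrow> real) \<Rightarrow>
   'q set \<Rightarrow> 'e set \<Rightarrow> ('q \<Rightarrow> real) \<Rightarrow> ('e \<Rightarrow> real) \<Rightarrow>
   ('p \<times> 'd \<Rightarrow> ('q \<times> 'e) set) \<Rightarrow> ('q \<times> 'e \<Rightarrow> 'p \<times> 'd) \<Rightarrow> bool" where
  "admissible F\<^sub>P F\<^sub>D f\<^sub>P f\<^sub>D G\<^sub>P G\<^sub>D g\<^sub>P g\<^sub>D M Minv \<longleftrightarrow>
     (\<forall>w \<in> F\<^sub>P \<times> F\<^sub>D. M w \<subseteq> G\<^sub>P \<times> G\<^sub>D) \<and>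
     (\<forall>z \<in> G\<^sub>P \<times> G\<^sub>D. Minv z \<in> F\<^sub>P \<times> F\<^sub>D) \<and>
     (\<forall>w \<in> F\<^sub>P \<times> F\<^sub>D. \<forall>z \<in> G\<^sub>P \<times> G\<^sub>D. z \<in> M w \<or> w = Minv z \<longrightarrow>
        f\<^sub>P (fst w) = g\<^sub>P (fst z) \<and> f\<^sub>D (snd w) = g\<^sub>D (snd z))"


subsection \<open>The mapping and its inverse\<close>

text \<open>The 0-based position of the first row of the block with 0-based index \<open>i\<close>, that is, $u_{i+1}-1$.\<close>

definition offset :: "nat list \<Rightarrow> nat \<Rightarrow> nat" where
  "offset ns i = (\<Sum>k < i. ns ! k)"

definition soco_to_sdo :: "nat list \<Rightarrow> real vec list \<times> (real vec \<times> real vec list) \<Rightarrow>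
    (real mat \<times> (real vec \<times> real mat)) set" where
  "soco_to_sdo ns = (\<lambda>(xs, y, ss). {(X, y', S).
     S = DArw ss \<and> y' = y \<and> X \<in> psd_mats (sum_list ns) \<and>
     (\<forall>i < length ns.
        (\<Sum>j < ns ! i. X $$ (offset ns i + j, offset ns i + j)) = xs ! i $ 0 \<and>
        (\<forall>j \<in> {1..<ns ! i}. X $$ (offset ns i, offset ns i + j) = xs ! i $ j / 2))})"

definition sdo_to_soco :: "nat list \<Rightarrow> real mat \<times> (real vec \<times> real mat) \<Rightarrow>
    real vec list \<times> (real vec \<times> real vec list)" where
  "sdo_to_soco ns = (\<lambda>(X, y, S).
     (map (\<lambda>i. vec (ns ! i) (\<lambda>j.
         if j = 0 then (\<Sum>l < ns ! i. X $$ (offset ns i + l, offset ns i + l))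
         else 2 * X $$ (offset ns i, offset ns i + j))) [0..<length ns],
      y, DArw_inv ns S))"

end

theory Submission
  imports Defs "HOL-Analysis.L2_Norm"
begin

text \<open>
  For symmetric \<open>X\<close>, the trace of \<open>DArw c * X\<close> only sees the diagonal blocks of \<open>X\<close> and equals the
  sum of the scalar products of the \<open>c\<^sup>i\<close> with the vectors \<open>x\<^sup>i\<close> that the inverse mapping reads off
  \<open>X\<close>; this gives the linear constraints and the objective at once.  These \<open>x\<^sup>i\<close> lie in the cone
  because \<open>X\<^sub>0\<^sub>j\<^sup>2 \<le> X\<^sub>0\<^sub>0 X\<^sub>j\<^sub>j\<close> and by AM-GM.  Applying this to \<open>X = v v\<^sup>T\<close> and using that the cone
  is self-dual, \<open>DArw s\<close> is positive semidefinite if and only if every \<open>s\<^sup>i\<close> is in its cone, which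
  settles the dual side.
\<close>

text \<open>It competes with \<open>sum.lessThan_Suc_shift\<close>, which splits off the head component.\<close>

declare sum.lessThan_Suc [simp del]

section \<open>Block indices\<close>

lemma offset_0 [simp]: "offset ns 0 = 0"
  by (simp add: offset_def)

lemma offset_Cons_Suc [simp]: "offset (n # ns) (Suc i) = n + offset ns i"
  by (simp add: offset_def sum.lessThan_Suc_shift)

lemma offset_add_less:
  assumes "i < length ns" "k < ns ! i"
  shows "offset ns i + k < sum_list ns"
  using assms
proof (induction ns arbitrary: i)
  case (Cons n ns)
  then show ?case by (cases i) (auto simp: add.assoc)
qed simp

lemma offset_add_le:
  assumes "j < i"
  shows "offset ns j + ns ! j \<le> offset ns i"
proof -
  have "offset ns j + ns ! j = (\<Sum>k < Suc j. ns ! k)" by (simp add: offset_def sum.lessThan_Suc)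
  also have "\<dots> \<le> offset ns i" unfolding offset_def using assms by (intro sum_mono2) auto
  finally show ?thesis .
qed

text \<open>Lets entrywise proofs of equations between block matrices pass from a global index to a
  block number and a position inside that block.\<close>

lemma offset_decompose:
  assumes "p < sum_list ns"
  obtains i k where "i < length ns" "k < ns ! i" "p = offset ns i + k"
proof -
  have "\<exists>i < length ns. \<exists>k < ns ! i. p = offset ns i + k"
    using assms
  proof (induction ns arbitrary: p)
    case (Cons n ns)
    show ?case
    proof (cases "p < n")
      case True
      then show ?thesis by (intro exI[of _ 0]) auto
    next
      case False
      with Cons.prems have "p - n < sum_list ns" by auto
      from Cons.IH[OF this] obtain i k
        where "i < length ns" "k < ns ! i" "p - n = offset ns i + k" by blast
      with False show ?thesis by (intro exI[of _ "Suc i"]) auto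
    qed
  qed simp
  then show thesis using that by blast
qed

lemma sum_blocks:
  fixes f :: "nat \<Rightarrow> 'a::comm_monoid_add"
  shows "(\<Sum>p < sum_list ns. f p) = (\<Sum>i < length ns. \<Sum>k < ns ! i. f (offset ns i + k))"
proof (induction ns arbitrary: f)
  case (Cons n ns)
  have split: "{..<n + sum_list ns} = {..<n} \<union> {n..<n + sum_list ns}" by auto
  have "(\<Sum>p < n + sum_list ns. f p) = (\<Sum>p < n. f p) + (\<Sum>p \<in> {n..<n + sum_list ns}. f p)"
    unfolding split by (rule sum.union_disjoint) auto
  also have "(\<Sum>p \<in> {n..<n + sum_list ns}. f p) = (\<Sum>p < sum_list ns. f (n + p))"
    by (rule sum.reindex_bij_witness[of _ "\<lambda>p. n + p" "\<lambda>p. p - n"]) auto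
  finally show ?case
    by (simp add: Cons.IH sum.lessThan_Suc_shift add.assoc)
qed simp

text \<open>\<open>diag_block_mat\<close> splits off one block at a time by
  \<open>four_block_mat\<close>; whether \<open>i\<close> and \<open>j\<close> are zero or
  successors decides which of its four parts is hit. Squareness lets row offsets serve for the
  columns too.\<close>

lemma index_diag_block_mat:
  assumes "\<And>A. A \<in> set Ms \<Longrightarrow> square_mat A"
    and "i < length Ms" "j < length Ms" "k < dim_row (Ms ! i)" "l < dim_row (Ms ! j)"
  shows "diag_block_mat Ms $$ (offset (map dim_row Ms) i + k, offset (map dim_row Ms) j + l) =
    (if i = j then Ms ! i $$ (k, l) else 0)"
  using assms
proof (induction Ms arbitrary: i j)
  case (Cons M Ms)
  have "map dim_col Ms = map dim_row Ms" "dim_col M = dim_row M"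
    using Cons.prems(1) by auto
  then have cols: "sum_list (map dim_col Ms) = sum_list (map dim_row Ms)" "dim_col M = dim_row M"
    by (simp_all only:)
  have inner: "offset (map dim_row Ms) i + k < sum_list (map dim_row Ms)"
    if "i < length Ms" "k < dim_row (Ms ! i)" for i k
    using that by (intro offset_add_less) auto
  have pos: "0 < sum_list (map dim_row Ms)" if "i < length Ms" "k < dim_row (Ms ! i)" for i k
    using inner[OF that] by simp
  show ?case
  proof (cases i)
    case 0
    then show ?thesis
      using Cons.prems by (cases j) (auto simp: cols Let_def dim_diag_block_mat add.assoc inner pos)
  next
    case (Suc i')
    then show ?thesis
      using Cons.prems Cons.IH[of i']
      by (cases j) (auto simp: cols Let_def dim_diag_block_mat add.assoc inner pos)
  qed
qed simp


section \<open>Arrow-head matrices\<close>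

lemma block_vecsD:
  assumes "xs \<in> block_vecs ns"
  shows "length xs = length ns" "i < length ns \<Longrightarrow> xs ! i \<in> carrier_vec (ns ! i)"
  using assms by (auto simp: block_vecs_def)

text \<open>\<open>Arw\<close> of the empty vector is still a 1-by-1 matrix, because the corner
  entry is always present. Hence the bound on \<open>n\<close>, which recurs as positivity of all
  block sizes.\<close>

lemma dim_Arw [simp]:
  assumes "x \<in> carrier_vec n" "n \<ge> 1"
  shows "dim_row (Arw x) = n" "dim_col (Arw x) = n"
  using assms by (auto simp: Arw_def)

lemma index_Arw:
  assumes "x \<in> carrier_vec n" "k < n" "l < n"
  shows "Arw x $$ (k, l) = (if k = l then x $ 0 else if k = 0 then x $ l else if l = 0 then x $ k else 0)"
proof -
  have "dim_vec x = n" using assms by auto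
  then show ?thesis
    using assms by (cases k; cases l) (auto simp: Arw_def mat_of_rows_def mat_of_cols_def vec_tail_def)
qed

lemma DArw_blocks:
  assumes "xs \<in> block_vecs ns" "\<forall>n \<in> set ns. n \<ge> 1"
  shows "DArw xs \<in> carrier_mat (sum_list ns) (sum_list ns)"
    and "i < length ns \<Longrightarrow> j < length ns \<Longrightarrow> k < ns ! i \<Longrightarrow> l < ns ! j \<Longrightarrow>
      DArw xs $$ (offset ns i + k, offset ns j + l) = (if i = j then Arw (xs ! i) $$ (k, l) else 0)"
proof -
  note bv = block_vecsD[OF assms(1)]
  have n1: "ns ! i \<ge> 1" if "i < length ns" for i
    using assms(2) that by auto
  have dims: "map dim_row (map Arw xs) = ns" "map dim_col (map Arw xs) = ns"
    using bv n1 by (auto intro!: nth_equalityI)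
  show "DArw xs \<in> carrier_mat (sum_list ns) (sum_list ns)"
    by (intro carrier_matI) (simp_all only: DArw_def dim_diag_block_mat dims)
  have sq: "square_mat A" if A: "A \<in> set (map Arw xs)" for A
  proof -
    from A obtain i where "i < length ns" "A = Arw (xs ! i)"
      using bv(1) by (auto simp: in_set_conv_nth)
    then show ?thesis using dim_Arw[OF bv(2) n1, of i] by simp
  qed
  show "DArw xs $$ (offset ns i + k, offset ns j + l) = (if i = j then Arw (xs ! i) $$ (k, l) else 0)"
    if ij: "i < length ns" "j < length ns" "k < ns ! i" "l < ns ! j"
  proof -
    have "dim_row (map Arw xs ! i) = ns ! i" "dim_row (map Arw xs ! j) = ns ! j"
      using bv n1 ij by simp_all
    with index_diag_block_mat[of "map Arw xs" i j k l, OF sq] show ?thesis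
      using ij bv(1) by (simp only: dims) (simp add: DArw_def)
  qed
qed

text \<open>The first row of each diagonal block lists the entries of its vector, so the tuple can
  be read off the matrix. This makes \<open>DArw_inv\<close> a genuine inverse on arrow-head
  matrices.\<close>

lemma DArw_inject:
  assumes xs: "xs \<in> block_vecs ns" and ys: "ys \<in> block_vecs ns"
    and pos: "\<forall>n \<in> set ns. n \<ge> 1" and eq: "DArw xs = DArw ys"
  shows "xs = ys"
proof (rule nth_equalityI)
  show "length xs = length ys" using block_vecsD(1)[OF xs] block_vecsD(1)[OF ys] by simp
  fix i assume "i < length xs"
  then have i: "i < length ns" using block_vecsD(1)[OF xs] by simp
  note x = block_vecsD(2)[OF xs i] and y = block_vecsD(2)[OF ys i]
  show "xs ! i = ys ! i"
  proof (rule eq_vecI)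
    show "dim_vec (xs ! i) = dim_vec (ys ! i)" using x y by auto
    fix j assume "j < dim_vec (ys ! i)"
    then have j: "j < ns ! i" using y by auto
    then have z: "0 < ns ! i" by simp
    have "Arw (xs ! i) $$ (0, j) = Arw (ys ! i) $$ (0, j)"
      using DArw_blocks(2)[OF xs pos i i z j] DArw_blocks(2)[OF ys pos i i z j] eq by simp
    then show "xs ! i $ j = ys ! i $ j"
      using index_Arw[OF x z j] index_Arw[OF y z j] by (auto split: if_splits)
  qed
qed

lemma DArw_inv_DArw:
  assumes "xs \<in> block_vecs ns" "\<forall>n \<in> set ns. n \<ge> 1"
  shows "DArw_inv ns (DArw xs) = xs"
  unfolding DArw_inv_def
  using assms by (intro inv_into_f_f inj_onI) (auto intro: DArw_inject)


section \<open>The adjoint of the arrow-head map\<close>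

text \<open>On symmetric \<open>Y\<close> this is the adjoint of \<open>Arw\<close> for the trace
  inner product. Taking \<open>Y\<close> as a function allows diagonal blocks and products
  \<open>v k * v l\<close> to be inserted without forming submatrices.\<close>

definition Arw_adj :: "nat \<Rightarrow> (nat \<Rightarrow> nat \<Rightarrow> real) \<Rightarrow> real vec" where
  "Arw_adj n Y = vec n (\<lambda>j. if j = 0 then \<Sum>l < n. Y l l else 2 * Y 0 j)"

lemma Arw_adj_carrier [simp]: "Arw_adj n Y \<in> carrier_vec n"
  by (simp add: Arw_adj_def)

lemma scalar_prod_Suc:
  assumes "y \<in> carrier_vec (Suc d)"
  shows "x \<bullet> y = x $ 0 * y $ 0 + (\<Sum>j < d. x $ Suc j * y $ Suc j)"
proof -
  have "x \<bullet> y = (\<Sum>j < Suc d. x $ j * y $ j)"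
    using assms by (simp add: scalar_prod_def lessThan_atLeast0)
  then show ?thesis by (simp only: sum.lessThan_Suc_shift)
qed

text \<open>The diagonal of \<open>Arw x\<close> is constant and produces the trace of
  \<open>Y\<close>. Each tail entry of \<open>x\<close> occurs once in row 0 and once in column 0,
  which by symmetry of \<open>Y\<close> gives the factor 2.\<close>

lemma Arw_adj:
  assumes x: "x \<in> carrier_vec n" and n: "n \<ge> 1"
    and sym: "\<And>k l. k < n \<Longrightarrow> l < n \<Longrightarrow> Y k l = Y l k"
  shows "(\<Sum>k < n. \<Sum>l < n. Arw x $$ (k, l) * Y l k) = x \<bullet> Arw_adj n Y"
proof -
  obtain d where d: "n = Suc d" using n by (cases n) auto
  have sym0: "Y (Suc j) 0 = Y 0 (Suc j)" if "j < d" for j using sym d that by simp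
  have row0: "(\<Sum>l < n. Arw x $$ (0, l) * Y l 0) = x $ 0 * Y 0 0 + (\<Sum>j < d. x $ Suc j * Y 0 (Suc j))"
    unfolding d sum.lessThan_Suc_shift
    using x by (simp add: index_Arw[where n = n] d sym0)
  have row: "(\<Sum>l < n. Arw x $$ (Suc k, l) * Y l (Suc k)) =
      x $ Suc k * Y 0 (Suc k) + x $ 0 * Y (Suc k) (Suc k)" if "k < d" for k
  proof -
    have diag: "Arw x $$ (Suc k, Suc l) * Y (Suc l) (Suc k) =
        (if k = l then x $ 0 * Y (Suc k) (Suc k) else 0)" if "l < d" for l
      using x that \<open>k < d\<close> by (simp add: index_Arw[where n = n] d)
    have "(\<Sum>l < n. Arw x $$ (Suc k, l) * Y l (Suc k)) =
        Arw x $$ (Suc k, 0) * Y 0 (Suc k) + (\<Sum>l < d. Arw x $$ (Suc k, Suc l) * Y (Suc l) (Suc k))"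
      by (simp only: d sum.lessThan_Suc_shift)
    also have "(\<Sum>l < d. Arw x $$ (Suc k, Suc l) * Y (Suc l) (Suc k)) =
        (\<Sum>l < d. if k = l then x $ 0 * Y (Suc k) (Suc k) else 0)"
      by (intro sum.cong refl diag) simp
    finally show ?thesis using x that by (simp add: index_Arw[where n = n] d)
  qed
  have "(\<Sum>k < n. \<Sum>l < n. Arw x $$ (k, l) * Y l k) =
      (\<Sum>l < n. Arw x $$ (0, l) * Y l 0) + (\<Sum>k < d. \<Sum>l < n. Arw x $$ (Suc k, l) * Y l (Suc k))"
    by (subst d, subst sum.lessThan_Suc_shift) (simp add: d)
  also have "\<dots> = x $ 0 * Y 0 0 + (\<Sum>j < d. x $ Suc j * Y 0 (Suc j))
      + (\<Sum>k < d. x $ Suc k * Y 0 (Suc k) + x $ 0 * Y (Suc k) (Suc k))"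
    by (simp add: row0 row)
  also have "\<dots> = x \<bullet> Arw_adj n Y"
    by (simp add: scalar_prod_Suc[of _ d] Arw_adj_def d sum.lessThan_Suc_shift sum.distrib
      sum_distrib_left algebra_simps)
  finally show ?thesis .
qed

definition diag_block :: "nat list \<Rightarrow> real mat \<Rightarrow> nat \<Rightarrow> nat \<Rightarrow> nat \<Rightarrow> real" where
  "diag_block ns X i k l = X $$ (offset ns i + k, offset ns i + l)"

lemma mat_trace_DArw_mult:
  assumes xs: "xs \<in> block_vecs ns" and pos: "\<forall>n \<in> set ns. n \<ge> 1"
    and X: "X \<in> carrier_mat (sum_list ns) (sum_list ns)" and sym: "transpose_mat X = X"
  shows "mat_trace (DArw xs * X) = (\<Sum>i < length ns. xs ! i \<bullet> Arw_adj (ns ! i) (diag_block ns X i))"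
proof -
  let ?N = "sum_list ns"
  note D = DArw_blocks[OF xs pos]
  have symX: "X $$ (p, q) = X $$ (q, p)" if "p < ?N" "q < ?N" for p q
    using that X sym by (metis carrier_matD index_transpose_mat(1))
  have "mat_trace (DArw xs * X) = (\<Sum>p < ?N. \<Sum>q < ?N. DArw xs $$ (p, q) * X $$ (q, p))"
    using D(1) X by (simp add: mat_trace_def scalar_prod_def lessThan_atLeast0)
  also have "\<dots> = (\<Sum>i < length ns. \<Sum>k < ns ! i. \<Sum>j < length ns. \<Sum>l < ns ! j.
      DArw xs $$ (offset ns i + k, offset ns j + l) * X $$ (offset ns j + l, offset ns i + k))"
    by (simp add: sum_blocks)
  \<comment> \<open>The off-diagonal blocks of \<open>DArw xs\<close> vanish, so those of
    \<open>X\<close> may be arbitrary.\<close>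
  also have "\<dots> = (\<Sum>i < length ns. \<Sum>k < ns ! i. \<Sum>j < length ns.
      if i = j then \<Sum>l < ns ! i. Arw (xs ! i) $$ (k, l) * diag_block ns X i l k else 0)"
    by (intro sum.cong refl) (auto simp: D(2) diag_block_def)
  also have "\<dots> = (\<Sum>i < length ns. \<Sum>k < ns ! i. \<Sum>l < ns ! i.
      Arw (xs ! i) $$ (k, l) * diag_block ns X i l k)"
    by (simp cong: sum.cong_simp)
  also have "\<dots> = (\<Sum>i < length ns. xs ! i \<bullet> Arw_adj (ns ! i) (diag_block ns X i))"
    using pos by (intro sum.cong refl Arw_adj block_vecsD(2)[OF xs])
      (auto simp: diag_block_def intro!: symX offset_add_less)
  finally show ?thesis .
qed


section \<open>Cones\<close>

text \<open>Expresses the norm of the tail by \<open>L2_set\<close>, for which Cauchy-Schwarz is at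
  hand.\<close>

lemma lorentz_cone_Suc:
  "x \<in> lorentz_cone (Suc d) \<longleftrightarrow> x \<in> carrier_vec (Suc d) \<and> L2_set (\<lambda>j. x $ Suc j) {..<d} \<le> x $ 0"
  by (auto simp: lorentz_cone_def norm2_def vec_tail_def L2_set_def scalar_prod_def power2_eq_square
      lessThan_atLeast0)

text \<open>By Cauchy-Schwarz the tails contribute at least minus the product of their norms, and
  the heads dominate these norms.\<close>

lemma lorentz_cone_scalar_prod_nonneg:
  assumes x: "x \<in> lorentz_cone n" and y: "y \<in> lorentz_cone n" and n: "n \<ge> 1"
  shows "x \<bullet> y \<ge> 0"
proof -
  obtain d where d: "n = Suc d" using n by (cases n) auto
  let ?x = "L2_set (\<lambda>j. x $ Suc j) {..<d}" and ?y = "L2_set (\<lambda>j. y $ Suc j) {..<d}"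
  have "- (\<Sum>j < d. x $ Suc j * y $ Suc j) \<le> (\<Sum>j < d. \<bar>x $ Suc j\<bar> * \<bar>y $ Suc j\<bar>)"
    unfolding sum_negf[symmetric] abs_mult[symmetric] by (intro sum_mono) auto
  also have "\<dots> \<le> ?x * ?y" by (rule L2_set_mult_ineq)
  also have "\<dots> \<le> x $ 0 * y $ 0"
    using x y by (intro mult_mono) (auto simp: d lorentz_cone_Suc L2_set_nonneg intro: order_trans[OF L2_set_nonneg])
  finally show ?thesis
    using y scalar_prod_Suc[of y d x] by (auto simp: d lorentz_cone_Suc)
qed

text \<open>Sum of the \<open>2 \<times> 2\<close> minors \<open>Y\<^sub>0\<^sub>j\<^sup>2 \<le> Y\<^sub>0\<^sub>0 Y\<^sub>j\<^sub>j\<close>, followed by AM-GM.\<close>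

lemma Arw_adj_in_lorentz_cone:
  assumes n: "n \<ge> 1"
    and diag: "\<And>k. k < n \<Longrightarrow> Y k k \<ge> 0"
    and minor: "\<And>j. j < n \<Longrightarrow> (Y 0 j)\<^sup>2 \<le> Y 0 0 * Y j j"
  shows "Arw_adj n Y \<in> lorentz_cone n"
proof -
  obtain d where d: "n = Suc d" using n by (cases n) auto
  \<comment> \<open>The head of the vector is the full trace \<open>?a + ?t\<close>, while the
    minors bound the squared norm of its tail by \<open>4 * (?a * ?t)\<close>.\<close>
  let ?a = "Y 0 0" and ?t = "\<Sum>j < d. Y (Suc j) (Suc j)"
  have a: "?a \<ge> 0" and t: "?t \<ge> 0" using diag d by (auto intro!: sum_nonneg)
  have "(\<Sum>j < d. (2 * Y 0 (Suc j))\<^sup>2) \<le> 4 * (?a * ?t)"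
    unfolding sum_distrib_left using minor d by (intro sum_mono) (auto simp: power_mult_distrib)
  also have "\<dots> \<le> (?a + ?t)\<^sup>2"
    using zero_le_power2[of "?a - ?t"] by (simp add: power2_eq_square algebra_simps)
  finally have "L2_set (\<lambda>j. 2 * Y 0 (Suc j)) {..<d} \<le> ?a + ?t"
    unfolding L2_set_def using a t by (intro real_le_lsqrt) auto
  moreover have "L2_set (\<lambda>j. Arw_adj n Y $ Suc j) {..<d} = L2_set (\<lambda>j. 2 * Y 0 (Suc j)) {..<d}"
    by (rule L2_set_cong) (auto simp: Arw_adj_def d)
  moreover have "Arw_adj n Y $ 0 = ?a + ?t"
    by (simp add: Arw_adj_def d sum.lessThan_Suc_shift)
  ultimately show ?thesis by (simp add: lorentz_cone_Suc d)
qed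

section \<open>Diagonal entries and 2-by-2 minors of positive semidefinite matrices\<close>

lemma nonneg_quadratic_imp_discriminant:
  fixes a b c :: real
  assumes "\<And>s t. s\<^sup>2 * a + 2 * s * t * b + t\<^sup>2 * c \<ge> 0"
  shows "b\<^sup>2 \<le> a * c"
proof -
  have a: "a \<ge> 0" using assms[of 1 0] by simp
  show ?thesis
  proof (cases "a = 0")
    case True
    have "b = 0"
    proof (rule ccontr)
      assume "b \<noteq> 0"
      \<comment> \<open>For \<open>a = 0\<close> the form at this point has the value
        \<open>-1\<close>.\<close>
      then show False using assms[of "- (c + 1) / (2 * b)" 1] True by (simp add: field_simps)
    qed
    then show ?thesis using True by simp
  next
    case False
    \<comment> \<open>The right-hand side is the value of the form at \<open>s = - b\<close>,
      \<open>t = a\<close>.\<close>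
    have "0 \<le> a * (a * c - b\<^sup>2)"
      using assms[of "- b" a] by (simp add: power2_eq_square algebra_simps)
    with False a show ?thesis by (simp add: zero_le_mult_iff)
  qed
qed

lemma quadratic_form_sum:
  assumes "X \<in> carrier_mat n n" "v \<in> carrier_vec n"
  shows "v \<bullet> (X *\<^sub>v v) = (\<Sum>p < n. \<Sum>q < n. v $ p * X $$ (p, q) * v $ q)"
  using assms by (simp add: scalar_prod_def lessThan_atLeast0 sum_distrib_left mult.assoc)

lemma psd_matsD:
  assumes "X \<in> psd_mats n"
  shows "X \<in> carrier_mat n n" "transpose_mat X = X"
    "p < n \<Longrightarrow> q < n \<Longrightarrow> X $$ (p, q) = X $$ (q, p)"
    "v \<in> carrier_vec n \<Longrightarrow> v \<bullet> (X *\<^sub>v v) \<ge> 0"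
proof -
  show X: "X \<in> carrier_mat n n" "transpose_mat X = X"
    "v \<in> carrier_vec n \<Longrightarrow> v \<bullet> (X *\<^sub>v v) \<ge> 0"
    using assms by (auto simp: psd_mats_def)
  show "X $$ (p, q) = X $$ (q, p)" if "p < n" "q < n"
    using that X by (metis carrier_matD index_transpose_mat(1))
qed

lemma psd_mats_diag_nonneg:
  assumes X: "X \<in> psd_mats n" and p: "p < n"
  shows "X $$ (p, p) \<ge> 0"
proof -
  have "unit_vec n p \<bullet> (X *\<^sub>v unit_vec n p) = X $$ (p, p)"
    using psd_matsD(1)[OF X] p by simp
  then show ?thesis using psd_matsD(4)[OF X unit_vec_carrier, of p] by simp
qed

text \<open>On vectors supported on \<open>p\<close> and \<open>q\<close> the quadratic form of
  \<open>X\<close> becomes a nonnegative binary form, and the claim is its discriminant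
  condition.\<close>

lemma psd_mats_minor:
  assumes X: "X \<in> psd_mats n" and p: "p < n" and q: "q < n"
  shows "(X $$ (p, q))\<^sup>2 \<le> X $$ (p, p) * X $$ (q, q)"
\<comment> \<open>For \<open>p = q\<close> the two-point test vector degenerates, but the claim is
  then an equality.\<close>
proof (cases "p = q")
  case True
  then show ?thesis by (simp add: power2_eq_square)
next
  case False
  show ?thesis
  proof (rule nonneg_quadratic_imp_discriminant)
    fix s t :: real
    let ?f = "\<lambda>k. if k = p then s else if k = q then t else 0"
    have sum2: "(\<Sum>k < n. ?f k * g k) = s * g p + t * g q" for g :: "nat \<Rightarrow> real"
    proof -
      have "(\<Sum>k < n. ?f k * g k) = (\<Sum>k < n. (if k = p then s * g k else 0) + (if k = q then t * g k else 0))"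
        using False by (intro sum.cong) auto
      also have "\<dots> = s * g p + t * g q" using p q by (simp add: sum.distrib)
      finally show ?thesis .
    qed
    have "vec n ?f \<bullet> (X *\<^sub>v vec n ?f) = (\<Sum>k < n. ?f k * (\<Sum>l < n. ?f l * X $$ (k, l)))"
      unfolding quadratic_form_sum[OF psd_matsD(1)[OF X] vec_carrier]
      unfolding sum_distrib_left by (intro sum.cong refl) auto
    also have "\<dots> = s\<^sup>2 * X $$ (p, p) + 2 * s * t * X $$ (p, q) + t\<^sup>2 * X $$ (q, q)"
      unfolding sum2 using psd_matsD(3)[OF X p q] by (simp add: power2_eq_square algebra_simps)
    finally show "0 \<le> s\<^sup>2 * X $$ (p, p) + 2 * s * t * X $$ (p, q) + t\<^sup>2 * X $$ (q, q)"
      using psd_matsD(4)[OF X vec_carrier, of ?f] by simp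
  qed
qed

lemma Arw_adj_diag_block_in_lorentz_cone:
  assumes X: "X \<in> psd_mats (sum_list ns)" and i: "i < length ns" and n: "ns ! i \<ge> 1"
  shows "Arw_adj (ns ! i) (diag_block ns X i) \<in> lorentz_cone (ns ! i)"
proof (rule Arw_adj_in_lorentz_cone[OF n])
  have less: "offset ns i + k < sum_list ns" if "k < ns ! i" for k
    using i that by (rule offset_add_less)
  show "0 \<le> diag_block ns X i k k" if "k < ns ! i" for k
    unfolding diag_block_def using psd_mats_diag_nonneg[OF X less[OF that]] .
  show "(diag_block ns X i 0 j)\<^sup>2 \<le> diag_block ns X i 0 0 * diag_block ns X i j j" if "j < ns ! i" for j
    unfolding diag_block_def using n that by (intro psd_mats_minor[OF X] less) auto
qed

section \<open>Positive semidefiniteness of \<open>DArw xs\<close> and cone membership of its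
  blocks\<close>

definition outer_mat :: "real vec \<Rightarrow> real mat" where
  "outer_mat v = mat (dim_vec v) (dim_vec v) (\<lambda>(p, q). v $ p * v $ q)"

lemma outer_mat_psd:
  assumes v: "v \<in> carrier_vec n"
  shows "outer_mat v \<in> psd_mats n"
proof -
  have "w \<bullet> (outer_mat v *\<^sub>v w) \<ge> 0" if w: "w \<in> carrier_vec n" for w
  proof -
    have c: "outer_mat v \<in> carrier_mat n n" using v by (simp add: outer_mat_def)
    \<comment> \<open>The form factors into two equal scalar products, hence is a square.\<close>
    have "w \<bullet> (outer_mat v *\<^sub>v w) = (\<Sum>p < n. w $ p * v $ p) * (\<Sum>q < n. v $ q * w $ q)"
      unfolding quadratic_form_sum[OF c w] using v by (simp add: outer_mat_def sum_product mult.assoc)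
    also have "(\<Sum>q < n. v $ q * w $ q) = (\<Sum>p < n. w $ p * v $ p)" by (simp add: mult.commute)
    finally show ?thesis by simp
  qed
  then show ?thesis
    using v by (auto simp: psd_mats_def outer_mat_def intro!: eq_matI)
qed

lemma DArw_transpose:
  assumes "xs \<in> block_vecs ns" "\<forall>n \<in> set ns. n \<ge> 1"
  shows "transpose_mat (DArw xs) = DArw xs"
proof (rule eq_matI)
  note D = DArw_blocks[OF assms]
  show "dim_row (transpose_mat (DArw xs)) = dim_row (DArw xs)"
    "dim_col (transpose_mat (DArw xs)) = dim_col (DArw xs)" using D(1) by auto
  fix p q assume "p < dim_row (DArw xs)" "q < dim_col (DArw xs)"
  then have pq: "p < sum_list ns" "q < sum_list ns" using D(1) by auto
  from pq(1) obtain i k where i: "i < length ns" "k < ns ! i" "p = offset ns i + k"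
    by (rule offset_decompose)
  from pq(2) obtain j l where j: "j < length ns" "l < ns ! j" "q = offset ns j + l"
    by (rule offset_decompose)
  have "DArw xs $$ (q, p) = DArw xs $$ (p, q)"
    using i j by (auto simp: D(2) index_Arw[OF block_vecsD(2)[OF assms(1)]])
  then show "transpose_mat (DArw xs) $$ (p, q) = DArw xs $$ (p, q)"
    using pq D(1) by auto
qed

text \<open>The quadratic form of \<open>DArw xs\<close> at \<open>v\<close> is the trace against the outer product of \<open>v\<close> with itself.\<close>

lemma quadratic_form_DArw:
  assumes xs: "xs \<in> block_vecs ns" and pos: "\<forall>n \<in> set ns. n \<ge> 1" and v: "v \<in> carrier_vec (sum_list ns)"
  shows "v \<bullet> (DArw xs *\<^sub>v v) =
    (\<Sum>i < length ns. xs ! i \<bullet> Arw_adj (ns ! i) (\<lambda>k l. v $ (offset ns i + k) * v $ (offset ns i + l)))"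
proof -
  have off: "offset ns i < sum_list ns" if "i < length ns" for i
    using offset_add_less[OF that, of 0] pos that by (simp add: Suc_le_eq)
  note D = DArw_blocks(1)[OF xs pos] and O = psd_matsD(1,2)[OF outer_mat_psd[OF v]]
  have "v \<bullet> (DArw xs *\<^sub>v v) = mat_trace (DArw xs * outer_mat v)"
    unfolding quadratic_form_sum[OF D v]
    using D v by (simp add: mat_trace_def scalar_prod_def lessThan_atLeast0 outer_mat_def mult_ac)
  also have "\<dots> = (\<Sum>i < length ns. xs ! i \<bullet> Arw_adj (ns ! i) (diag_block ns (outer_mat v) i))"
    by (rule mat_trace_DArw_mult[OF xs pos O])
  also have "\<dots> = (\<Sum>i < length ns. xs ! i \<bullet> Arw_adj (ns ! i) (\<lambda>k l. v $ (offset ns i + k) * v $ (offset ns i + l)))"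
    using v by (intro sum.cong refl arg_cong2[of _ _ _ _ scalar_prod])
      (auto simp: Arw_adj_def diag_block_def outer_mat_def offset_add_less off)
  finally show ?thesis .
qed

text \<open>Each summand of the quadratic form pairs \<open>xs ! i\<close> with the adjoint of a
  rank-one matrix. The minor inequalities of that matrix are equalities, so the adjoint lies in the
  cone, and two cone elements have a nonnegative scalar product.\<close>

lemma DArw_psd:
  assumes xs: "xs \<in> block_vecs ns" and pos: "\<forall>n \<in> set ns. n \<ge> 1"
    and cone: "\<And>i. i < length ns \<Longrightarrow> xs ! i \<in> lorentz_cone (ns ! i)"
  shows "DArw xs \<in> psd_mats (sum_list ns)"
proof -
  have "v \<bullet> (DArw xs *\<^sub>v v) \<ge> 0" if v: "v \<in> carrier_vec (sum_list ns)" for v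
    unfolding quadratic_form_DArw[OF xs pos v]
  proof (rule sum_nonneg)
    fix i assume "i \<in> {..<length ns}"
    then have i: "i < length ns" and n: "ns ! i \<ge> 1" using pos by auto
    have "Arw_adj (ns ! i) (\<lambda>k l. v $ (offset ns i + k) * v $ (offset ns i + l)) \<in> lorentz_cone (ns ! i)"
      by (rule Arw_adj_in_lorentz_cone[OF n]) (auto simp: power2_eq_square)
    then show "xs ! i \<bullet> Arw_adj (ns ! i) (\<lambda>k l. v $ (offset ns i + k) * v $ (offset ns i + l)) \<ge> 0"
      using cone[OF i] n by (intro lorentz_cone_scalar_prod_nonneg) auto
  qed
  then show ?thesis
    using DArw_blocks(1)[OF xs pos] DArw_transpose[OF xs pos] by (simp add: psd_mats_def)
qed

text \<open>Membership is tested against the boundary vector \<open>(1, - s / \<bar>s\<bar>)\<close>, where \<open>s\<close> is the tail of \<open>x\<close>;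
  for \<open>s = 0\<close> the convention \<open>0 / 0 = 0\<close> makes it the first unit vector.\<close>

lemma in_lorentz_cone_if_Arw_nonneg:
  assumes x: "x \<in> carrier_vec n" and n: "n \<ge> 1"
    and nonneg: "\<And>v. x \<bullet> Arw_adj n (\<lambda>k l. v k * v l) \<ge> 0"
  shows "x \<in> lorentz_cone n"
proof -
  obtain d where d: "n = Suc d" using n by (cases n) auto
  define r where "r = L2_set (\<lambda>j. x $ Suc j) {..<d}"
  have r0: "r \<ge> 0" by (simp add: r_def L2_set_nonneg)
  have r2: "(\<Sum>j < d. (x $ Suc j)\<^sup>2) = r\<^sup>2"
    by (simp add: r_def L2_set_def sum_nonneg)
  define v where "v k = (if k = 0 then 1 else - x $ k / r)" for k
  have "x \<bullet> Arw_adj n (\<lambda>k l. v k * v l) =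
      x $ 0 * (1 + (\<Sum>j < d. (x $ Suc j)\<^sup>2) / r\<^sup>2) - 2 * ((\<Sum>j < d. (x $ Suc j)\<^sup>2) / r)"
    by (simp add: scalar_prod_Suc[of _ d] Arw_adj_def d sum.lessThan_Suc_shift v_def sum_divide_distrib
        sum_distrib_left sum_negf power2_eq_square algebra_simps)
  then have "0 \<le> x $ 0 * (1 + r\<^sup>2 / r\<^sup>2) - 2 * (r\<^sup>2 / r)"
    using nonneg[of v] by (simp add: r2)
  \<comment> \<open>If \<open>r\<close> is nonzero, the inequality reads
    \<open>0 \<le> 2 * (x $ 0 - r)\<close>; if \<open>r = 0\<close>, both quotients are 0 and it
    reads \<open>0 \<le> x $ 0\<close>.\<close>
  then have "r \<le> x $ 0"
    by (cases "r = 0") (auto simp: power2_eq_square)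
  then show ?thesis using x by (simp add: lorentz_cone_Suc d r_def)
qed

text \<open>Test vectors supported on block \<open>i\<close> annihilate all other summands of the
  quadratic form, which leaves exactly the nonnegativity that the preceding criterion asks of
  \<open>xs ! i\<close>.\<close>

lemma DArw_psd_imp_lorentz_cone:
  assumes xs: "xs \<in> block_vecs ns" and pos: "\<forall>n \<in> set ns. n \<ge> 1"
    and psd: "DArw xs \<in> psd_mats (sum_list ns)" and i: "i < length ns"
  shows "xs ! i \<in> lorentz_cone (ns ! i)"
proof (rule in_lorentz_cone_if_Arw_nonneg)
  show "xs ! i \<in> carrier_vec (ns ! i)" by (rule block_vecsD(2)[OF xs i])
  show "ns ! i \<ge> 1" using pos i by simp
  fix v :: "nat \<Rightarrow> real"
  \<comment> \<open>The extension of \<open>v\<close> by zero outside block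
    \<open>i\<close>.\<close>
  define w where "w = vec (sum_list ns)
    (\<lambda>p. if offset ns i \<le> p \<and> p < offset ns i + ns ! i then v (p - offset ns i) else 0)"
  have w: "w \<in> carrier_vec (sum_list ns)" by (simp add: w_def)
  have w_in: "w $ (offset ns i + k) = v k" if "k < ns ! i" for k
    using that offset_add_less[OF i that] by (simp add: w_def)
  have w_out: "w $ (offset ns j + k) = 0" if "j < length ns" "k < ns ! j" "j \<noteq> i" for j k
  proof -
    consider "j < i" | "i < j" using \<open>j \<noteq> i\<close> by linarith
    then have "offset ns j + k < offset ns i \<or> offset ns i + ns ! i \<le> offset ns j + k"
      by cases (use that(2) offset_add_le[of _ _ ns] in \<open>fastforce+\<close>)
    then show ?thesis using offset_add_less[OF that(1,2)] by (auto simp: w_def)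
  qed
  have "0 \<le> w \<bullet> (DArw xs *\<^sub>v w)" by (rule psd_matsD(4)[OF psd w])
  also have "\<dots> = (\<Sum>j < length ns. if j = i then xs ! i \<bullet> Arw_adj (ns ! i) (\<lambda>k l. v k * v l) else 0)"
    unfolding quadratic_form_DArw[OF xs pos w]
  proof (rule sum.cong[OF refl])
    fix j assume "j \<in> {..<length ns}"
    then have j: "j < length ns" and n: "0 < ns ! j" using pos by (auto simp: Suc_le_eq)
    have "Arw_adj (ns ! j) (\<lambda>k l. w $ (offset ns j + k) * w $ (offset ns j + l)) =
        (if j = i then Arw_adj (ns ! i) (\<lambda>k l. v k * v l) else 0\<^sub>v (ns ! j))"
      using w_in w_out[OF j] n w_in[of 0] w_out[OF j, of 0] by (auto simp: Arw_adj_def intro!: eq_vecI)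
    then show "xs ! j \<bullet> Arw_adj (ns ! j) (\<lambda>k l. w $ (offset ns j + k) * w $ (offset ns j + l)) =
        (if j = i then xs ! i \<bullet> Arw_adj (ns ! i) (\<lambda>k l. v k * v l) else 0)"
      using block_vecsD(2)[OF xs j] by simp
  qed
  also have "\<dots> = xs ! i \<bullet> Arw_adj (ns ! i) (\<lambda>k l. v k * v l)" using i by simp
  finally show "0 \<le> xs ! i \<bullet> Arw_adj (ns ! i) (\<lambda>k l. v k * v l)" .
qed

section \<open>Feasibility\<close>

text \<open>Every entry of an arrow-head matrix is linear in the vector. Naming the sum as a tuple
  \<open>zs\<close> of its own allows \<open>cs\<close> to be put there directly.\<close>

lemma DArw_add:
  assumes xs: "xs \<in> block_vecs ns" and ys: "ys \<in> block_vecs ns" and pos: "\<forall>n \<in> set ns. n \<ge> 1"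
    and zs: "zs \<in> block_vecs ns" and sum: "\<And>i. i < length ns \<Longrightarrow> zs ! i = xs ! i + ys ! i"
  shows "DArw xs + DArw ys = DArw zs"
proof (rule eq_matI)
  note X = DArw_blocks[OF xs pos] and Y = DArw_blocks[OF ys pos] and Z = DArw_blocks[OF zs pos]
  show "dim_row (DArw xs + DArw ys) = dim_row (DArw zs)" "dim_col (DArw xs + DArw ys) = dim_col (DArw zs)"
    using X(1) Y(1) Z(1) by auto
  fix p q assume "p < dim_row (DArw zs)" "q < dim_col (DArw zs)"
  then have pq: "p < sum_list ns" "q < sum_list ns" using Z(1) by auto
  from pq(1) obtain i k where i: "i < length ns" "k < ns ! i" "p = offset ns i + k"
    by (rule offset_decompose)
  from pq(2) obtain j l where j: "j < length ns" "l < ns ! j" "q = offset ns j + l"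
    by (rule offset_decompose)
  note x = block_vecsD(2)[OF xs i(1)] and y = block_vecsD(2)[OF ys i(1)]
  have "DArw xs $$ (p, q) + DArw ys $$ (p, q) = DArw zs $$ (p, q)"
    using i j x y by (auto simp: X(2) Y(2) Z(2) sum index_Arw[where n = "ns ! i"])
  then show "(DArw xs + DArw ys) $$ (p, q) = DArw zs $$ (p, q)"
    using pq Y(1) by auto
qed

lemma transpose_mult_block_vecs:
  assumes "length As = length ns" and "\<forall>i < length ns. As ! i \<in> carrier_mat m (ns ! i)"
  shows "map (\<lambda>A. transpose_mat A *\<^sub>v y) As \<in> block_vecs ns"
  using assms by (auto simp: block_vecs_def intro!: carrier_vecI dest: carrier_matD(2))

lemma row_block_vecs:
  assumes "length As = length ns" and "\<forall>i < length ns. As ! i \<in> carrier_mat m (ns ! i)"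
  shows "map (\<lambda>A. row A j) As \<in> block_vecs ns"
  using assms by (auto simp: block_vecs_def intro!: carrier_vecI dest: carrier_matD(2))

text \<open>By linearity, block \<open>i\<close> of the combination is the arrow-head matrix of the
  rows of \<open>As ! i\<close> combined with weights \<open>y\<close>, and this combination of rows
  is the transpose applied to \<open>y\<close>.\<close>

lemma sum_sdo_A:
  assumes len: "length As = length ns" and As: "\<forall>i < length ns. As ! i \<in> carrier_mat m (ns ! i)"
    and pos: "\<forall>n \<in> set ns. n \<ge> 1" and y: "y \<in> carrier_vec m"
  shows "mat (sum_list ns) (sum_list ns) (\<lambda>kl. \<Sum>j < m. y $ j * sdo_A As j $$ kl) =
    DArw (map (\<lambda>A. transpose_mat A *\<^sub>v y) As)" (is "?L = DArw ?ts")
proof (rule eq_matI)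
  have ts: "?ts \<in> block_vecs ns" by (rule transpose_mult_block_vecs[OF len As])
  have rows: "map (\<lambda>A. row A j) As \<in> block_vecs ns" for j by (rule row_block_vecs[OF len As])
  note T = DArw_blocks[OF ts pos] and R = DArw_blocks[OF rows pos]
  show "dim_row ?L = dim_row (DArw ?ts)" "dim_col ?L = dim_col (DArw ?ts)" using T(1) by auto
  fix p q assume "p < dim_row (DArw ?ts)" "q < dim_col (DArw ?ts)"
  then have pq: "p < sum_list ns" "q < sum_list ns" using T(1) by auto
  from pq(1) obtain i k where i: "i < length ns" "k < ns ! i" "p = offset ns i + k"
    by (rule offset_decompose)
  from pq(2) obtain j l where j: "j < length ns" "l < ns ! j" "q = offset ns j + l"
    by (rule offset_decompose)
  have A: "As ! i \<in> carrier_mat m (ns ! i)" using As i by simp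
  have comp: "(transpose_mat (As ! i) *\<^sub>v y) $ k = (\<Sum>h < m. y $ h * row (As ! i) h $ k)"
    if "k < ns ! i" for k
    using A y that by (auto simp: scalar_prod_def lessThan_atLeast0 mult.commute intro!: sum.cong)
  have t: "transpose_mat (As ! i) *\<^sub>v y \<in> carrier_vec (ns ! i)"
    and r: "row (As ! i) h \<in> carrier_vec (ns ! i)" for h
    using mult_mat_vec_carrier[OF _ y, of "transpose_mat (As ! i)"] row_carrier[of "As ! i" h] A by simp_all
  show "?L $$ (p, q) = DArw ?ts $$ (p, q)"
  proof (cases "i = j")
    case True
    then have l: "l < ns ! i" using j by simp
    then have "Arw (transpose_mat (As ! i) *\<^sub>v y) $$ (k, l) = (\<Sum>h < m. y $ h * Arw (row (As ! i) h) $$ (k, l))"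
      using i by (simp add: index_Arw[OF t] index_Arw[OF r] comp del: index_mult_mat_vec index_row)
    then show ?thesis
      using pq i l j(3) True len by (simp add: T(2) R(2) sdo_A_def)
  next
    case False
    then show ?thesis using pq i j by (simp add: T(2) R(2) sdo_A_def)
  qed
qed

text \<open>The linear constraint of the semidefinite dual is an equation between two arrow-head
  matrices, which injectivity of \<open>DArw\<close> reduces to the blockwise constraints. The conic
  constraints match by the characterization of semidefinite arrow-head matrices.\<close>

lemma dual_feasible_iff:
  assumes len: "length As = length ns" and As: "\<forall>i < length ns. As ! i \<in> carrier_mat m (ns ! i)"
    and pos: "\<forall>n \<in> set ns. n \<ge> 1" and cs: "cs \<in> block_vecs ns" and ss: "ss \<in> block_vecs ns"
  shows "(y, DArw ss) \<in> sdo_dual ns m As cs \<longleftrightarrow> (y, ss) \<in> soco_dual ns m As cs"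
proof (cases "y \<in> carrier_vec m")
  case y: True
  let ?ts = "map (\<lambda>A. transpose_mat A *\<^sub>v y) As"
  let ?us = "map (\<lambda>i. ?ts ! i + ss ! i) [0..<length ns]"
  have ts: "?ts \<in> block_vecs ns" by (rule transpose_mult_block_vecs[OF len As])
  have us: "?us \<in> block_vecs ns"
    using block_vecsD(2)[OF ts] block_vecsD(2)[OF ss] by (auto simp: block_vecs_def)
  have "DArw ?ts + DArw ss = DArw ?us" by (rule DArw_add[OF ts ss pos us]) simp
  then have "DArw ?ts + DArw ss = DArw cs \<longleftrightarrow> ?us = cs"
    using DArw_inject[OF us cs pos] by auto
  also have "\<dots> \<longleftrightarrow> (\<forall>i < length ns. transpose_mat (As ! i) *\<^sub>v y + ss ! i = cs ! i)"
    unfolding list_eq_iff_nth_eq[of ?us cs] using block_vecsD(1)[OF cs] len by simp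
  finally show ?thesis
    using y ss DArw_psd[OF ss pos] DArw_psd_imp_lorentz_cone[OF ss pos]
    by (auto simp: sdo_dual_def soco_dual_def sum_sdo_A[OF len As pos y] sdo_C_def)
qed (simp add: sdo_dual_def soco_dual_def)

text \<open>A feasible slack is the difference of two arrow-head matrices, hence itself one, with
  blocks built from \<open>c^i - (A^i)^T y\<close>. This justifies applying \<open>DArw_inv\<close>
  to it.\<close>

lemma sdo_dual_slack_DArw:
  assumes len: "length As = length ns" and As: "\<forall>i < length ns. As ! i \<in> carrier_mat m (ns ! i)"
    and pos: "\<forall>n \<in> set ns. n \<ge> 1" and cs: "cs \<in> block_vecs ns"
    and S: "(y, S) \<in> sdo_dual ns m As cs"
  obtains ss where "ss \<in> block_vecs ns" "S = DArw ss"
proof -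
  from S have y: "y \<in> carrier_vec m" by (simp add: sdo_dual_def)
  let ?ts = "map (\<lambda>A. transpose_mat A *\<^sub>v y) As"
  let ?ss = "map (\<lambda>i. cs ! i - ?ts ! i) [0..<length ns]"
  have ts: "?ts \<in> block_vecs ns" by (rule transpose_mult_block_vecs[OF len As])
  have ss: "?ss \<in> block_vecs ns"
    using block_vecsD(2)[OF ts] block_vecsD(2)[OF cs] by (auto simp: block_vecs_def)
  have carr: "S \<in> carrier_mat (sum_list ns) (sum_list ns)" and eq: "DArw ?ts + S = DArw cs"
    using S by (auto simp: sdo_dual_def sum_sdo_A[OF len As pos y] sdo_C_def psd_mats_def)
  have "DArw ?ts + DArw ?ss = DArw cs"
  proof (rule DArw_add[OF ts ss pos cs])
    fix i assume i: "i < length ns"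
    show "cs ! i = ?ts ! i + ?ss ! i"
      using block_vecsD(2)[OF ts i] block_vecsD(2)[OF cs i] i by (auto intro!: eq_vecI)
  qed
  then have eq2: "DArw ?ts + S = DArw ?ts + DArw ?ss" using eq by simp
  have "S = DArw ?ss"
  proof (rule eq_matI)
    note D = DArw_blocks(1)[OF ss pos]
    show "dim_row S = dim_row (DArw ?ss)" "dim_col S = dim_col (DArw ?ss)" using carr D by auto
    fix p q assume "p < dim_row (DArw ?ss)" "q < dim_col (DArw ?ss)"
    then show "S $$ (p, q) = DArw ?ss $$ (p, q)"
      using arg_cong[OF eq2, of "\<lambda>M. M $$ (p, q)"] carr D by simp
  qed
  with ss show thesis by (rule that)
qed

section \<open>The primal side: both mappings expressed by \<open>collapse\<close>, the adjoint of
  \<open>DArw\<close> on symmetric matrices\<close>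

definition collapse :: "nat list \<Rightarrow> real mat \<Rightarrow> real vec list" where
  "collapse ns X = map (\<lambda>i. Arw_adj (ns ! i) (diag_block ns X i)) [0..<length ns]"

lemma collapse_block_vecs: "collapse ns X \<in> block_vecs ns"
  by (simp add: collapse_def block_vecs_def)

lemma sdo_to_soco_eq: "sdo_to_soco ns (X, y, S) = (collapse ns X, y, DArw_inv ns S)"
  by (simp add: sdo_to_soco_def collapse_def Arw_adj_def diag_block_def cong: if_cong)

text \<open>The trace conditions fix the heads, and halving the tail entries undoes the doubling in
  \<open>Arw_adj\<close>. So the forward map returns precisely the semidefinite \<open>X\<close>
  that the inverse map sends back to \<open>xs\<close>, and one analysis of \<open>collapse\<close>
  serves both directions.\<close>

lemma soco_to_sdo_iff:
  assumes "xs \<in> block_vecs ns" and "\<forall>n \<in> set ns. n \<ge> 1"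
  shows "(X, y', S) \<in> soco_to_sdo ns (xs, y, ss) \<longleftrightarrow>
    S = DArw ss \<and> y' = y \<and> X \<in> psd_mats (sum_list ns) \<and> xs = collapse ns X"
proof -
  have "(\<Sum>j < ns ! i. X $$ (offset ns i + j, offset ns i + j)) = xs ! i $ 0 \<and>
        (\<forall>j \<in> {1..<ns ! i}. X $$ (offset ns i, offset ns i + j) = xs ! i $ j / 2) \<longleftrightarrow>
      xs ! i = Arw_adj (ns ! i) (diag_block ns X i)" if i: "i < length ns" for i
  proof -
    have x: "dim_vec (xs ! i) = ns ! i" and n: "0 < ns ! i"
      using block_vecsD(2)[OF assms(1) i] assms(2) i by (auto simp: Suc_le_eq)
    have "xs ! i = Arw_adj (ns ! i) (diag_block ns X i) \<longleftrightarrow>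
        (\<forall>j < ns ! i. xs ! i $ j = Arw_adj (ns ! i) (diag_block ns X i) $ j)"
      using x by (auto simp: Arw_adj_def intro!: eq_vecI)
    also have "\<dots> \<longleftrightarrow> xs ! i $ 0 = (\<Sum>j < ns ! i. X $$ (offset ns i + j, offset ns i + j)) \<and>
        (\<forall>j \<in> {1..<ns ! i}. xs ! i $ j = 2 * X $$ (offset ns i, offset ns i + j))"
      using n by (auto simp: Arw_adj_def diag_block_def)
    finally show ?thesis by (auto simp: field_simps)
  qed
  then show ?thesis
    unfolding list_eq_iff_nth_eq[of xs] using block_vecsD(1)[OF assms(1)]
    by (auto simp: soco_to_sdo_def collapse_def)
qed

lemma primal_obj_eq:
  assumes cs: "cs \<in> block_vecs ns" and pos: "\<forall>n \<in> set ns. n \<ge> 1" and X: "X \<in> psd_mats (sum_list ns)"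
  shows "soco_primal_obj cs (collapse ns X) = sdo_primal_obj cs X"
  using mat_trace_DArw_mult[OF cs pos psd_matsD(1,2)[OF X]] block_vecsD(1)[OF cs]
  by (simp add: soco_primal_obj_def sdo_primal_obj_def sdo_C_def collapse_def)

text \<open>The trace identity, applied to row \<open>j\<close> of all the \<open>As ! i\<close>,
  identifies the trace constraints with the components of the linear system. The cone conditions
  hold automatically, since \<open>X\<close> is positive semidefinite.\<close>

lemma primal_feasible_iff:
  assumes len: "length As = length ns" and As: "\<forall>i < length ns. As ! i \<in> carrier_mat m (ns ! i)"
    and pos: "\<forall>n \<in> set ns. n \<ge> 1" and b: "b \<in> carrier_vec m" and X: "X \<in> psd_mats (sum_list ns)"
  shows "collapse ns X \<in> soco_primal ns m As b \<longleftrightarrow> X \<in> sdo_primal ns m As b"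
proof -
  let ?xs = "collapse ns X"
  have tr: "mat_trace (sdo_A As j * X) = (\<Sum>i < length ns. (As ! i *\<^sub>v ?xs ! i) $ j)" if "j < m" for j
    unfolding sdo_A_def mat_trace_DArw_mult[OF row_block_vecs[OF len As] pos psd_matsD(1,2)[OF X]]
    using that len As by (intro sum.cong refl) (auto simp: collapse_def)
  have mem: "(\<lambda>i. As ! i *\<^sub>v ?xs ! i) \<in> {..<length ns} \<rightarrow> carrier_vec m"
    using As by (intro Pi_I carrier_vecI) (auto dest: carrier_matD(1))
  let ?s = "finsum_vec TYPE(real) m (\<lambda>i. As ! i *\<^sub>v ?xs ! i) {..<length ns}"
  have s: "?s \<in> carrier_vec m" by (rule finsum_vec_closed[OF mem])
  have "?s = b \<longleftrightarrow> (\<forall>j < m. ?s $ j = b $ j)"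
    unfolding vec_eq_iff carrier_vecD[OF s] carrier_vecD[OF b] by simp
  also have "\<dots> \<longleftrightarrow> (\<forall>j < m. mat_trace (sdo_A As j * X) = b $ j)"
    using tr index_finsum_vec[OF finite_lessThan _ mem] by simp
  finally have "?s = b \<longleftrightarrow> (\<forall>j < m. mat_trace (sdo_A As j * X) = b $ j)" .
  moreover have "\<forall>i < length ns. ?xs ! i \<in> lorentz_cone (ns ! i)"
    using Arw_adj_diag_block_in_lorentz_cone[OF X] pos by (simp add: collapse_def)
  ultimately show ?thesis
    using X collapse_block_vecs by (simp add: soco_primal_def sdo_primal_def)
qed

theorem theorem3p8:
  fixes ns :: "nat list" and m :: nat
    and As :: "real mat list" and cs :: "real vec list" and b :: "real vec"
  assumes "length ns \<ge> 1" and "\<forall>n \<in> set ns. n \<ge> 1"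
    and "length As = length ns" and "\<forall>i < length ns. As ! i \<in> carrier_mat m (ns ! i)"
    and "cs \<in> block_vecs ns"
    and "b \<in> carrier_vec m"
  shows "admissible
    (soco_primal ns m As b) (soco_dual ns m As cs) (soco_primal_obj cs) (\<lambda>(y, ss). b \<bullet> y)
    (sdo_primal ns m As b) (sdo_dual ns m As cs) (sdo_primal_obj cs) (\<lambda>(y, S). b \<bullet> y)
    (soco_to_sdo ns) (sdo_to_soco ns)"
proof -
  note pos = assms(2) and cs = assms(5)
  note primal_iff = primal_feasible_iff[OF assms(3,4,2,6)]
    and dual_iff = dual_feasible_iff[OF assms(3,4,2,5)]
  have primalD: "xs \<in> block_vecs ns" if "xs \<in> soco_primal ns m As b" for xs
    using that by (simp add: soco_primal_def)
  have dualD: "ss \<in> block_vecs ns" if "(y, ss) \<in> soco_dual ns m As cs" for y ss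
    using that by (simp add: soco_dual_def)
  have psd: "X \<in> psd_mats (sum_list ns)" if "X \<in> sdo_primal ns m As b" for X
    using that by (simp add: sdo_primal_def)
  have inv_dual: "(y, DArw_inv ns S) \<in> soco_dual ns m As cs" if S: "(y, S) \<in> sdo_dual ns m As cs" for y S
  proof -
    \<comment> \<open>\<open>DArw_inv\<close> is defined by choice, so its value is known only once
      \<open>S\<close> is exhibited as some \<open>DArw ss\<close>.\<close>
    obtain ss where ss: "ss \<in> block_vecs ns" "S = DArw ss"
      using sdo_dual_slack_DArw[OF assms(3,4,2,5) S] .
    then show ?thesis using S dual_iff[OF ss(1)] DArw_inv_DArw[OF ss(1) pos] by simp
  qed
  show ?thesis
    unfolding admissible_def
  proof (intro conjI ballI impI)
    fix w assume w: "w \<in> soco_primal ns m As b \<times> soco_dual ns m As cs"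
    show "soco_to_sdo ns w \<subseteq> sdo_primal ns m As b \<times> sdo_dual ns m As cs"
    proof
      fix z assume z: "z \<in> soco_to_sdo ns w"
      obtain xs y ss where w_eq: "w = (xs, y, ss)" by (cases w)
      obtain X y' S where z_eq: "z = (X, y', S)" by (cases z)
      show "z \<in> sdo_primal ns m As b \<times> sdo_dual ns m As cs"
        using w z soco_to_sdo_iff[OF primalD pos] primal_iff dual_iff[OF dualD]
        unfolding w_eq z_eq by auto
    qed
  next
    fix z assume "z \<in> sdo_primal ns m As b \<times> sdo_dual ns m As cs"
    then show "sdo_to_soco ns z \<in> soco_primal ns m As b \<times> soco_dual ns m As cs"
      using primal_iff[OF psd] inv_dual by (cases z) (auto simp: sdo_to_soco_eq)
  next
    fix w z
    assume w: "w \<in> soco_primal ns m As b \<times> soco_dual ns m As cs"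
      and z: "z \<in> sdo_primal ns m As b \<times> sdo_dual ns m As cs"
      and wz: "z \<in> soco_to_sdo ns w \<or> w = sdo_to_soco ns z"
    obtain xs y ss where w_eq: "w = (xs, y, ss)" by (cases w)
    obtain X y' S where z_eq: "z = (X, y', S)" by (cases z)
    \<comment> \<open>Whichever map relates the two points, the outcome is the same pair of
      equations, and these determine both objective values.\<close>
    have "xs = collapse ns X \<and> y' = y"
      using wz w soco_to_sdo_iff[OF primalD pos] unfolding w_eq z_eq by (auto simp: sdo_to_soco_eq)
    then show "soco_primal_obj cs (fst w) = sdo_primal_obj cs (fst z)"
        "(case snd w of (y, ss) \<Rightarrow> b \<bullet> y) = (case snd z of (y, S) \<Rightarrow> b \<bullet> y)"
      using z primal_obj_eq[OF cs pos psd] unfolding w_eq z_eq by auto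
  qed
qed

end
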